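(* Let $X$ and $Y$ be sets with large scale structures $\mathcal{LSS}_X$ and $\mathcal{LSS}_Y$ respectively. If $f\colon(X,\mathcal{LSS}_X)\to(Y,\mathcal{LSS}_Y)$ is a large scale uniform function, then $$\mathrm{asdim}(X,\mathcal{LSS}_X)\leq\mathrm{asdim}(f)+\mathrm{asdim}(Y,\mathcal{LSS}_Y).$$
   Context: For $B\subset X$ and a family $\mathcal U$ of subsets of $X$, the star $\mathrm{St}(B,\mathcal U)$ is the union of those elements of $\mathcal U$ that intersect $B$. For families $\mathcal B,\mathcal U$ of subsets of $X$, $\mathrm{St}(\mathcal B,\mathcal U)=\{\mathrm{St}(B,\mathcal U)\}_{B\in\mathcal B}$. A large scale structure $\mathcal{LSS}_X$ on a set $X$ is a non-empty set of families of subsets of $X$ (the uniformly bounded families) such that: (1) if $\mathcal B_1\in\mathcal{LSS}_X$ and $\mathcal B_2$ is a family of subsets of $X$ such that each element of $\mathcal B_2$ consisting of more than one point is contained in some element of $\mathcal B_1$, then $\mathcal B_2\in\mathcal{LSS}_X$; (2) $\mathcal B_1,\mathcal B_2\in\mathcal{LSS}_X$ implies $\mathrm{St}(\mathcal B_1,\mathcal B_2)\in\mathcal{LSS}_X$. A family $\mathcal B$ refines $\mathcal B'$ if every element of $\mathcal B$ is contained in some element of $\mathcal B'$. The trivial extension of $\mathcal B$ is $e(\mathcal B)=\mathcal B\cup\{\{x\}\}_{x\in X}$. Let $\mathcal{LSS}'_X$ be a set of families of subsets of $X$ such that for all $\mathcal B_1,\mathcal B_2\in\mathcal{LSS}'_X$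 there is $\mathcal B_3\in\mathcal{LSS}'_X$ such that $\mathcal B_1\cup\mathcal B_2\cup\mathrm{St}(\mathcal B_1,\mathcal B_2)$ refines $\mathcal B_3$. The large scale structure $\mathcal{LSS}_X$ is generated by $\mathcal{LSS}'_X$ if it consists of all refinements of trivial extensions of elements of $\mathcal{LSS}'_X$. The multiplicity of a family $\mathcal B$ is at most $m$ if each point of $X$ is contained in at most $m$ elements of $\mathcal B$. For an integer $n\ge 0$, $\mathrm{asdim}(X,\mathcal{LSS}_X)\leq n$ means that $\mathcal{LSS}_X$ is generated by a set of families each of multiplicity at most $n+1$; $\mathrm{asdim}(X,\mathcal{LSS}_X)$ is the smallest such $n$ ($\infty$ if there is none). A function $f\colon(X,\mathcal{LSS}_X)\to(Y,\mathcal{LSS}_Y)$ is large scale uniform if $f(\mathcal B)=\{f(B)\}_{B\in\mathcal B}\in\mathcal{LSS}_Y$ for all $\mathcal B\in\mathcal{LSS}_X$. Given a family $\{A_s\}_{s\in S}$ of subsets of $X$, the disjoint union $\bigoplus_{s\in S}A_s$ carries the following large scale structure: a family $\mathcal B$ of subsets of $\bigoplus_{s\in S}A_s$ is uniformly bounded if and only if each element of $\mathcal B$ is contained in a single summand $A_s$ and there is $\mathcal D\in\mathcal{LSS}_X$ such that, for every $s\in S$, every element of $\mathcal B$ contained in the summand $A_s$, regarded as a subset of $X$, is contained in some element of $\mathcal D$. For a family $\mathcal A$ of subsets of $X$, $\bigoplus\mathcal A$ denotes the disjoint union of all its members. For a function $f\colon(X,\mathcal{LSS}_X)\to(Y,\mathcal{LSS}_Y)$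 and an integer $n\ge 0$, $\mathrm{asdim}(f)\leq n$ means that $\mathrm{asdim}(\bigoplus f^{-1}(\mathcal B))\leq n$ for all $\mathcal B\in\mathcal{LSS}_Y$, where $f^{-1}(\mathcal B)=\{f^{-1}(B)\}_{B\in\mathcal B}$; $\mathrm{asdim}(f)$ is the smallest such $n$ ($\infty$ if there is none). *)

theory Defs
  imports Complex_Main "HOL-Library.Extended_Nat" "HOL-Library.FuncSet"
begin

text \<open>
  Spaces are carrier sets and a family of subsets of \<open>X\<close> is an element of \<open>Pow (Pow X)\<close>,
  that is, a set of sets, not an indexed family.
\<close>

definition star :: "'a set \<Rightarrow> 'a set set \<Rightarrow> 'a set" where
  "star B \<U> = \<Union> {U \<in> \<U>. U \<inter> B \<noteq> {}}"

definition star_family :: "'a set set \<Rightarrow> 'a set set \<Rightarrow> 'a set set" where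
  "star_family \<B> \<U> = (\<lambda>B. star B \<U>) ` \<B>"

definition large_scale_structure :: "'a set \<Rightarrow> 'a set set set \<Rightarrow> bool" where
  "large_scale_structure X L \<longleftrightarrow>
     L \<noteq> {} \<and> L \<subseteq> Pow (Pow X) \<and>
     (\<forall>\<B>1\<in>L. \<forall>\<B>2\<in>Pow (Pow X).
        (\<forall>B\<in>\<B>2. (\<exists>x\<in>B. \<exists>y\<in>B. x \<noteq> y) \<longrightarrow> (\<exists>B'\<in>\<B>1. B \<subseteq> B')) \<longrightarrow> \<B>2 \<in> L) \<and>
     (\<forall>\<B>1\<in>L. \<forall>\<B>2\<in>L. star_family \<B>1 \<B>2 \<in> L)"

definition refines :: "'a set set \<Rightarrow> 'a set set \<Rightarrow> bool" where
  "refines \<B> \<B>' \<longleftrightarrow> (\<forall>B\<in>\<B>. \<exists>B'\<in>\<B>'. B \<subseteq> B')"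

definition trivial_extension :: "'a set \<Rightarrow> 'a set set \<Rightarrow> 'a set set" where
  "trivial_extension X \<B> = \<B> \<union> (\<lambda>x. {x}) ` X"

definition generated_by :: "'a set \<Rightarrow> 'a set set set \<Rightarrow> 'a set set set \<Rightarrow> bool" where
  "generated_by X L L' \<longleftrightarrow>
     L' \<subseteq> Pow (Pow X) \<and>
     (\<forall>\<B>1\<in>L'. \<forall>\<B>2\<in>L'. \<exists>\<B>3\<in>L'. refines (\<B>1 \<union> \<B>2 \<union> star_family \<B>1 \<B>2) \<B>3) \<and>
     L = {\<B> \<in> Pow (Pow X). \<exists>\<C>\<in>L'. refines \<B> (trivial_extension X \<C>)}"

text \<open>Finiteness is required explicitly because \<open>card\<close> is \<open>0\<close> on infinite sets.\<close>

definition multiplicity_le :: "'a set \<Rightarrow> 'a set set \<Rightarrow> nat \<Rightarrow> bool" where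
  "multiplicity_le X \<B> m \<longleftrightarrow>
     (\<forall>x\<in>X. finite {B \<in> \<B>. x \<in> B} \<and> card {B \<in> \<B>. x \<in> B} \<le> m)"

definition asdim_le :: "'a set \<Rightarrow> 'a set set set \<Rightarrow> nat \<Rightarrow> bool" where
  "asdim_le X L n \<longleftrightarrow>
     (\<exists>L'. generated_by X L L' \<and> (\<forall>\<B>\<in>L'. multiplicity_le X \<B> (n + 1)))"

definition least_or_infinity :: "(nat \<Rightarrow> bool) \<Rightarrow> enat" where
  "least_or_infinity P = (if \<exists>n. P n then enat (LEAST n. P n) else \<infinity>)"

definition asdim :: "'a set \<Rightarrow> 'a set set set \<Rightarrow> enat" where
  "asdim X L = least_or_infinity (asdim_le X L)"

definition large_scale_uniform ::
    "'a set set set \<Rightarrow> 'b set set set \<Rightarrow> ('a \<Rightarrow> 'b) \<Rightarrow> bool" where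
  "large_scale_uniform LX LY f \<longleftrightarrow> (\<forall>\<B>\<in>LX. (\<lambda>B. f ` B) ` \<B> \<in> LY)"

text \<open>
  The disjoint union of \<open>A s\<close> for \<open>s \<in> S\<close> is \<open>Sigma S A\<close>, with summands \<open>{s} \<times> A s\<close>;
  \<open>snd\<close> regards a subset of a summand as a subset of the ambient space.
\<close>

definition disjoint_union_structure ::
    "'a set set set \<Rightarrow> 's set \<Rightarrow> ('s \<Rightarrow> 'a set) \<Rightarrow> ('s \<times> 'a) set set set" where
  "disjoint_union_structure L S A =
     {\<B> \<in> Pow (Pow (Sigma S A)).
        (\<forall>B\<in>\<B>. \<exists>s\<in>S. B \<subseteq> {s} \<times> A s) \<and>
        (\<exists>\<D>\<in>L. \<forall>s\<in>S. \<forall>B\<in>\<B>. B \<subseteq> {s} \<times> A s \<longrightarrow> (\<exists>D\<in>\<D>. snd ` B \<subseteq> D))}"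

definition preimage_family :: "'a set \<Rightarrow> ('a \<Rightarrow> 'b) \<Rightarrow> 'b set set \<Rightarrow> 'a set set" where
  "preimage_family X f \<B> = (\<lambda>B. f -` B \<inter> X) ` \<B>"

text \<open>The disjoint union of the members of a family is indexed by the members themselves.\<close>

definition family_sum :: "'a set set \<Rightarrow> ('a set \<times> 'a) set" where
  "family_sum \<A> = Sigma \<A> (\<lambda>A. A)"

definition family_sum_structure ::
    "'a set set set \<Rightarrow> 'a set set \<Rightarrow> ('a set \<times> 'a) set set set" where
  "family_sum_structure L \<A> = disjoint_union_structure L \<A> (\<lambda>A. A)"

definition asdim_map_le ::
    "'a set \<Rightarrow> 'a set set set \<Rightarrow> 'b set set set \<Rightarrow> ('a \<Rightarrow> 'b) \<Rightarrow> nat \<Rightarrow> bool" where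
  "asdim_map_le X LX LY f n \<longleftrightarrow>
     (\<forall>\<B>\<in>LY. asdim (family_sum (preimage_family X f \<B>))
                    (family_sum_structure LX (preimage_family X f \<B>)) \<le> enat n)"

definition asdim_map ::
    "'a set \<Rightarrow> 'a set set set \<Rightarrow> 'b set set set \<Rightarrow> ('a \<Rightarrow> 'b) \<Rightarrow> enat" where
  "asdim_map X LX LY f = least_or_infinity (asdim_map_le X LX LY f)"

end

theory Submission
  imports Defs
begin

text \<open>
  Put \<open>k = m + n + 1\<close> with \<open>m\<close> and \<open>n\<close> the dimensions of \<open>f\<close> and \<open>Y\<close>. By Kolmogorov's trick, \<open>Y\<close> is
  covered by \<open>k\<close> sets \<open>B i\<close> with uniformly bounded components so that each point lies in at least
  \<open>k - n\<close> of them, and likewise preimages of bounded sets are covered by \<open>k\<close> such sets with each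
  point in at least \<open>k - m\<close> of them. The latter are glued to subsets \<open>A i\<close> of \<open>X\<close> by a finite union
  argument over the \<open>n + 1\<close> colours of a decomposition of \<open>Y\<close> at a scale exceeding the components
  of the \<open>B i\<close>. As \<open>(k - n) + (k - m) > k\<close>, the sets \<open>A i \<inter> f -` B i\<close> cover \<open>X\<close>, and a chain in
  one of them has bounded image, hence is itself bounded.
\<close>

section \<open>Controlled relations\<close>

text \<open>These are the entourages of the coarse structure attached to \<open>L\<close>. Relations
  replace families so that stars become compositions and chains become closures.\<close>

definition controlled :: "'a set \<Rightarrow> 'a set set set \<Rightarrow> ('a \<times> 'a) set \<Rightarrow> bool" where
  "controlled X L R \<longleftrightarrow>
     R \<subseteq> X \<times> X \<and> (\<exists>\<U>\<in>L. \<forall>x y. (x, y) \<in> R \<longrightarrow> (\<exists>U\<in>\<U>. x \<in> U \<and> y \<in> U))"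

lemma large_scale_structure_coarsen:
  assumes "large_scale_structure X L" "\<B> \<in> L" "\<C> \<subseteq> Pow X"
    and "\<And>C x y. C \<in> \<C> \<Longrightarrow> x \<in> C \<Longrightarrow> y \<in> C \<Longrightarrow> x \<noteq> y \<Longrightarrow> \<exists>B\<in>\<B>. C \<subseteq> B"
  shows "\<C> \<in> L"
proof -
  have "\<forall>\<B>1\<in>L. \<forall>\<B>2\<in>Pow (Pow X).
      (\<forall>B\<in>\<B>2. (\<exists>x\<in>B. \<exists>y\<in>B. x \<noteq> y) \<longrightarrow> (\<exists>B'\<in>\<B>1. B \<subseteq> B')) \<longrightarrow> \<B>2 \<in> L"
    using assms(1) unfolding large_scale_structure_def by (elim conjE)
  from bspec[OF bspec[OF this assms(2)], of \<C>] show ?thesis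
    using assms(3,4) by simp blast
qed

lemma large_scale_structure_star:
  assumes "large_scale_structure X L" "\<B> \<in> L" "\<C> \<in> L"
  shows "star_family \<B> \<C> \<in> L"
  using assms unfolding large_scale_structure_def by blast

lemma large_scale_structure_subset:
  assumes "large_scale_structure X L" "\<B> \<in> L"
  shows "\<B> \<subseteq> Pow X"
  using assms unfolding large_scale_structure_def by blast

text \<open>Axiom (1) tests only sets with two distinct points, so adding singletons costs
  nothing.\<close>

lemma trivial_extension_in:
  assumes "large_scale_structure X L" "\<B> \<in> L"
  shows "trivial_extension X \<B> \<in> L"
  by (rule large_scale_structure_coarsen[OF assms])
     (use large_scale_structure_subset[OF assms] in \<open>unfold trivial_extension_def, blast+\<close>)

lemma controlled_mono:
  "controlled X L R \<Longrightarrow> S \<subseteq> R \<Longrightarrow> controlled X L S"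
  unfolding controlled_def by blast

lemma controlled_family:
  assumes "large_scale_structure X L" "\<B> \<in> L"
  shows "controlled X L (\<Union>B\<in>\<B>. B \<times> B)"
  using large_scale_structure_subset[OF assms] assms(2) unfolding controlled_def by blast

lemma controlled_Id_on:
  assumes "large_scale_structure X L"
  shows "controlled X L (Id_on X)"
proof -
  have "L \<noteq> {}"
    using assms unfolding large_scale_structure_def by (elim conjE)
  then obtain \<B> where "\<B> \<in> L" by blast
  from trivial_extension_in[OF assms this] show ?thesis
    unfolding controlled_def
    by (intro conjI bexI[of _ "trivial_extension X \<B>"]) (auto simp: trivial_extension_def)
qed

lemma controlled_converse:
  "controlled X L R \<Longrightarrow> controlled X L (R\<inverse>)"
  unfolding controlled_def by (metis converse_iff converse_Times converse_mono)

text \<open>A pair in \<open>R O S\<close> passes through a point shared by some \<open>U\<close>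
  and \<open>V\<close>, hence lies in the star of \<open>U\<close>. The singletons added to
  \<open>\<V>\<close> put the points of \<open>U\<close> itself into that star.\<close>

lemma controlled_comp:
  assumes L: "large_scale_structure X L" and "controlled X L R" "controlled X L S"
  shows "controlled X L (R O S)"
proof -
  obtain \<U> \<V> where UV: "\<U> \<in> L" "\<V> \<in> L"
    and R: "\<And>x y. (x, y) \<in> R \<Longrightarrow> \<exists>U\<in>\<U>. x \<in> U \<and> y \<in> U"
    and S: "\<And>x y. (x, y) \<in> S \<Longrightarrow> \<exists>U\<in>\<V>. x \<in> U \<and> y \<in> U"
    and sub: "R \<subseteq> X \<times> X" "S \<subseteq> X \<times> X"
    using assms unfolding controlled_def by blast
  let ?W = "star_family \<U> (trivial_extension X \<V>)"
  have "\<exists>W\<in>?W. x \<in> W \<and> z \<in> W" if xy: "(x, y) \<in> R" and yz: "(y, z) \<in> S" for x y z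
  proof -
    obtain U V where "U \<in> \<U>" "x \<in> U" "y \<in> U" "V \<in> \<V>" "y \<in> V" "z \<in> V"
      using R[OF xy] S[OF yz] by blast
    moreover have "x \<in> X" using sub xy by blast
    ultimately have "x \<in> star U (trivial_extension X \<V>)" "z \<in> star U (trivial_extension X \<V>)"
      unfolding star_def trivial_extension_def by blast+
    then show ?thesis
      using \<open>U \<in> \<U>\<close> unfolding star_family_def by blast
  qed
  moreover have "?W \<in> L"
    using large_scale_structure_star[OF L] trivial_extension_in[OF L] UV by blast
  ultimately show ?thesis
    using sub unfolding controlled_def by blast
qed

text \<open>A pair from \<open>R\<close> lies in the star of its \<open>U\<close>, a pair from
  \<open>S\<close> in the star of \<open>{x}\<close>; extending both families provides for the two
  cases.\<close>

lemma controlled_Un: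
  assumes L: "large_scale_structure X L" and "controlled X L R" "controlled X L S"
  shows "controlled X L (R \<union> S)"
proof -
  obtain \<U> \<V> where UV: "\<U> \<in> L" "\<V> \<in> L"
    and R: "\<And>x y. (x, y) \<in> R \<Longrightarrow> \<exists>U\<in>\<U>. x \<in> U \<and> y \<in> U"
    and S: "\<And>x y. (x, y) \<in> S \<Longrightarrow> \<exists>U\<in>\<V>. x \<in> U \<and> y \<in> U"
    and sub: "R \<subseteq> X \<times> X" "S \<subseteq> X \<times> X"
    using assms unfolding controlled_def by blast
  let ?W = "star_family (trivial_extension X \<U>) (trivial_extension X \<V>)"
  have "\<exists>W\<in>?W. x \<in> W \<and> y \<in> W" if xy: "(x, y) \<in> R \<union> S" for x y
  proof -
    have X: "x \<in> X" "y \<in> X" using sub xy by blast+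
    consider U where "U \<in> \<U>" "x \<in> U" "y \<in> U" | V where "V \<in> \<V>" "x \<in> V" "y \<in> V"
      using R S xy by blast
    then show ?thesis
    proof cases
      case 1
      then have "x \<in> star U (trivial_extension X \<V>)" "y \<in> star U (trivial_extension X \<V>)"
        using X unfolding star_def trivial_extension_def by blast+
      then show ?thesis
        using 1 unfolding star_family_def trivial_extension_def by blast
    next
      case 2
      then have "x \<in> star {x} (trivial_extension X \<V>)" "y \<in> star {x} (trivial_extension X \<V>)"
        using X unfolding star_def trivial_extension_def by blast+
      then show ?thesis
        using X unfolding star_family_def trivial_extension_def by blast
    qed
  qed
  moreover have "?W \<in> L"
    using large_scale_structure_star[OF L] trivial_extension_in[OF L] UV by blast
  ultimately show ?thesis
    using sub unfolding controlled_def by (intro conjI bexI[of _ ?W]) auto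
qed

text \<open>Intersecting with \<open>X \<times> X\<close> matters for \<open>k = 0\<close>, where
  \<open>R ^^ 0\<close> is the identity on the whole type.\<close>

lemma controlled_relpow:
  assumes L: "large_scale_structure X L" and "controlled X L R"
  shows "controlled X L (R ^^ k \<inter> X \<times> X)"
proof (induction k)
  case 0
  show ?case by (rule controlled_mono[OF controlled_Id_on[OF L]]) auto
next
  case (Suc k)
  have "R \<subseteq> X \<times> X" using assms(2) unfolding controlled_def by blast
  then have "R ^^ Suc k \<inter> X \<times> X \<subseteq> (R ^^ k \<inter> X \<times> X) O R" by auto
  then show ?case
    using controlled_mono controlled_comp[OF L Suc assms(2)] by blast
qed

text \<open>The way back from relations to families: an \<open>R\<close>-small set lies in the star
  of any of its points, and the stars of singletons are uniformly bounded.\<close>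

lemma family_in_if_controlled:
  assumes L: "large_scale_structure X L" and R: "controlled X L R"
    and "\<B> \<subseteq> Pow X" and B: "\<And>B. B \<in> \<B> \<Longrightarrow> B \<times> B \<subseteq> R"
  shows "\<B> \<in> L"
proof -
  obtain \<U> where U: "\<U> \<in> L" and RU: "\<And>x y. (x, y) \<in> R \<Longrightarrow> \<exists>U\<in>\<U>. x \<in> U \<and> y \<in> U"
    using R unfolding controlled_def by blast
  let ?S = "(\<lambda>x. {x}) ` X"
  have "?S \<in> L"
    by (rule large_scale_structure_coarsen[OF L U]) auto
  then have W: "star_family ?S \<U> \<in> L"
    using large_scale_structure_star[OF L] U by blast
  show ?thesis
  proof (rule large_scale_structure_coarsen[OF L W \<open>\<B> \<subseteq> Pow X\<close>])
    fix C x y assume C: "C \<in> \<B>" "x \<in> C" "y \<in> C"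
    have "C \<subseteq> star {x} \<U>"
    proof
      fix z assume "z \<in> C"
      then obtain U where "U \<in> \<U>" "x \<in> U" "z \<in> U"
        using RU B C by blast
      then show "z \<in> star {x} \<U>" unfolding star_def by blast
    qed
    moreover have "x \<in> X" using C \<open>\<B> \<subseteq> Pow X\<close> by blast
    ultimately show "\<exists>B\<in>star_family ?S \<U>. C \<subseteq> B"
      unfolding star_family_def by blast
  qed
qed

lemma controlled_symmetric_reflexive:
  assumes L: "large_scale_structure X L" and R: "controlled X L R"
  obtains E where "controlled X L E" "R \<subseteq> E" "sym E" "Id_on X \<subseteq> E"
proof
  show "controlled X L (R \<union> R\<inverse> \<union> Id_on X)"
    using controlled_Un[OF L] controlled_converse[OF R] controlled_Id_on[OF L] R by blast
  show "sym (R \<union> R\<inverse> \<union> Id_on X)" unfolding sym_def by blast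
qed auto

text \<open>Large scale uniformity of \<open>f\<close> enters the proof only through this
  lemma.\<close>

lemma controlled_image:
  assumes "large_scale_structure Y LY" "large_scale_uniform LX LY f" "f \<in> X \<rightarrow> Y"
    and "controlled X LX R"
  shows "controlled Y LY (map_prod f f ` R)"
proof -
  obtain \<U> where U: "\<U> \<in> LX" and RU: "\<And>x y. (x, y) \<in> R \<Longrightarrow> \<exists>U\<in>\<U>. x \<in> U \<and> y \<in> U"
    and "R \<subseteq> X \<times> X"
    using assms(4) unfolding controlled_def by blast
  have "(\<lambda>B. f ` B) ` \<U> \<in> LY"
    using U assms(2) unfolding large_scale_uniform_def by blast
  moreover have "map_prod f f ` R \<subseteq> Y \<times> Y" using \<open>R \<subseteq> X \<times> X\<close> assms(3) by auto
  moreover have "\<forall>x y. (x, y) \<in> map_prod f f ` R \<longrightarrow> (\<exists>U\<in>(\<lambda>B. f ` B) ` \<U>. x \<in> U \<and> y \<in> U)"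
    using RU by fastforce
  ultimately show ?thesis unfolding controlled_def by blast
qed

section \<open>Chains\<close>

text \<open>For symmetric \<open>E\<close> reflexive on \<open>A\<close> the classes are the
  \<open>E\<close>-components of \<open>A\<close>. The reflexive closure is avoided because it would
  leave \<open>A \<times> A\<close>.\<close>

definition chained :: "('a \<times> 'a) set \<Rightarrow> 'a set \<Rightarrow> ('a \<times> 'a) set" where
  "chained E A = (E \<inter> A \<times> A)\<^sup>+"

lemma chained_subset: "chained E A \<subseteq> A \<times> A"
  unfolding chained_def by (rule trancl_subset_Sigma) auto

lemma chained_mono: "E \<subseteq> E' \<Longrightarrow> A \<subseteq> A' \<Longrightarrow> chained E A \<subseteq> chained E' A'"
  unfolding chained_def by (rule trancl_mono_subset) auto

lemma chained_trans: "(x, y) \<in> chained E A \<Longrightarrow> (y, z) \<in> chained E A \<Longrightarrow> (x, z) \<in> chained E A"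
  unfolding chained_def by (rule trancl_trans)

lemma chained_sym: "sym E \<Longrightarrow> (x, y) \<in> chained E A \<Longrightarrow> (y, x) \<in> chained E A"
  unfolding chained_def
  by (metis sym_Int sym_def sym_trancl mem_Sigma_iff)

lemma chained_step: "(x, y) \<in> E \<Longrightarrow> x \<in> A \<Longrightarrow> y \<in> A \<Longrightarrow> (x, y) \<in> chained E A"
  unfolding chained_def by blast

text \<open>
  A chain in \<open>P \<union> Q\<close> that meets \<open>Q\<close> is cut at its first and last point in \<open>Q\<close>; in between, the
  excursions into \<open>P\<close> are absorbed by the coarser relation \<open>E'\<close>.
\<close>

lemma chained_Un:
  assumes P: "chained E P \<subseteq> F" and Q: "chained E' Q \<subseteq> F'"
    and E': "E \<union> E O F O E \<subseteq> E'" and refl: "Id_on P \<subseteq> E"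
  shows "chained E (P \<union> Q) \<subseteq> F \<union> (Id_on Q \<union> F O E) O (Id_on Q \<union> F') O (Id_on Q \<union> E O F)"
proof (rule subrelI)
  fix x y assume "(x, y) \<in> chained E (P \<union> Q)"
  \<comment> \<open>A stretch through a single point of \<open>P\<close> is represented by a
    loop.\<close>
  have PP: "(u, u) \<in> chained E P" if "u \<in> P" for u
    using that refl by (intro chained_step) auto
  let ?first = "\<lambda>q. x = q \<or> (\<exists>p. (x, p) \<in> chained E P \<and> (p, q) \<in> E)"
  let ?last = "\<lambda>q y. q = y \<or> (\<exists>p. (q, p) \<in> E \<and> (p, y) \<in> chained E P)"
  \<comment> \<open>Invariant of a chain that has met \<open>Q\<close>: it enters \<open>Q\<close>
    at \<open>q\<close>, moves within \<open>Q\<close> by \<open>E'\<close> to \<open>q'\<close>,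
    and may since then be on an excursion into \<open>P\<close>.\<close>
  define J where "J y \<longleftrightarrow> (\<exists>q q'. q \<in> Q \<and> q' \<in> Q \<and> ?first q \<and>
      (q = q' \<or> (q, q') \<in> chained E' Q) \<and> ?last q' y)" for y
  have "(x, y) \<in> chained E P \<or> J y"
    using \<open>(x, y) \<in> chained E (P \<union> Q)\<close> unfolding chained_def[of E "P \<union> Q"]
  proof (induction rule: trancl_induct)
    case (base y)
    then consider "x \<in> P" "y \<in> P" | "x \<in> P" "y \<in> Q" | "x \<in> Q" "y \<in> P" | "x \<in> Q" "y \<in> Q"
      by blast
    then show ?case
    proof cases
      case 1
      then have "(x, y) \<in> chained E P" using base by (intro chained_step) auto
      then show ?thesis by blast
    next
      case 2
      then show ?thesis using base PP unfolding J_def by blast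
    next
      case 3
      then show ?thesis using base PP unfolding J_def by blast
    next
      case 4
      then have "(x, y) \<in> chained E' Q" using base E' by (intro chained_step) auto
      then show ?thesis using 4 unfolding J_def by blast
    qed
  next
    case (step y z)
    then have yz: "(y, z) \<in> E" "z \<in> P \<union> Q" by auto
    from step.IH show ?case
    proof
      assume xy: "(x, y) \<in> chained E P"
      then have "y \<in> P" using chained_subset by blast
      show ?thesis
      proof (cases "z \<in> P")
        case True
        then show ?thesis using xy yz chained_step[OF yz(1) \<open>y \<in> P\<close>] chained_trans by fast
      next
        case False
        then show ?thesis using xy yz unfolding J_def by blast
      qed
    next
      assume "J y"
      then obtain q q' where q: "q \<in> Q" "q' \<in> Q" "?first q"
          "q = q' \<or> (q, q') \<in> chained E' Q" "?last q' y"
        unfolding J_def by blast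
      show ?thesis
      proof (cases "z \<in> P")
        case True
        have "?last q' z"
        proof (cases "q' = y")
          case True
          then show ?thesis using yz PP \<open>z \<in> P\<close> by blast
        next
          case False
          then obtain p where p: "(q', p) \<in> E" "(p, y) \<in> chained E P" using q by blast
          then have "y \<in> P" using chained_subset by blast
          then have "(p, z) \<in> chained E P"
            using p yz \<open>z \<in> P\<close> by (meson chained_step chained_trans)
          then show ?thesis using p by blast
        qed
        then show ?thesis using q unfolding J_def by blast
      next
        case False
        then have "z \<in> Q" using yz by blast
        have "(q', z) \<in> E'" using q(5) yz P E' by blast
        then have "(q', z) \<in> chained E' Q" using q \<open>z \<in> Q\<close> by (intro chained_step)
        then have "(q, z) \<in> chained E' Q" using q(4) chained_trans by fast
        then show ?thesis using q \<open>z \<in> Q\<close> unfolding J_def by blast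
      qed
    qed
  qed
  then show "(x, y) \<in> F \<union> (Id_on Q \<union> F O E) O (Id_on Q \<union> F') O (Id_on Q \<union> E O F)"
  proof
    assume "J y"
    then obtain q q' where q: "q \<in> Q" "q' \<in> Q" "?first q"
          "q = q' \<or> (q, q') \<in> chained E' Q" "?last q' y"
      unfolding J_def by blast
    then have "(x, q) \<in> Id_on Q \<union> F O E" "(q, q') \<in> Id_on Q \<union> F'" "(q', y) \<in> Id_on Q \<union> E O F"
      using P Q by blast+
    then show ?thesis by blast
  qed (use P in blast)
qed

section \<open>Kolmogorov's trick\<close>

text \<open>Membership means depth at least \<open>j\<close> in \<open>C\<close>, measured in
  \<open>E\<close>-steps; for \<open>j = 0\<close> it is membership in
  \<open>C \<inter> X\<close>.\<close>

definition erosion :: "'a set \<Rightarrow> ('a \<times> 'a) set \<Rightarrow> nat \<Rightarrow> 'a set \<Rightarrow> 'a set" where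
  "erosion X E j C = {x \<in> X. (E ^^ j) `` {x} \<subseteq> C}"

lemma erosion_antimono:
  assumes "Id_on X \<subseteq> E" "i \<le> j"
  shows "erosion X E j C \<subseteq> erosion X E i C"
  using assms(2)
proof (induction rule: dec_induct)
  case (step j)
  have "(x, y) \<in> E ^^ Suc j" if "x \<in> X" "(x, y) \<in> E ^^ j" for x y
    using that assms(1) by (intro relpow_Suc_I2) auto
  then have "erosion X E (Suc j) C \<subseteq> erosion X E j C"
    unfolding erosion_def by blast
  with step show ?case by blast
qed simp

lemma erosion_step:
  assumes "x \<in> erosion X E (Suc j) C" "(x, y) \<in> E" "y \<in> X"
  shows "y \<in> erosion X E j C"
  using assms relpow_Suc_I2[OF assms(2)] unfolding erosion_def by blast

text \<open>
  The set \<open>A j\<close> consists of the points whose depth in no member of the cover is exactly \<open>j\<close>. Depth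
  changes by at most one along \<open>E\<close>, so a chain in \<open>A j\<close> cannot leave a member in which it starts at
  depth more than \<open>j\<close>; and of the at most \<open>n + 1\<close> members containing a point, one has depth at least
  \<open>k\<close> there, while each of the others excludes that point from at most one \<open>A j\<close>.
\<close>

lemma kolmogorov_decomposition:
  assumes E: "Id_on X \<subseteq> E" "E \<subseteq> X \<times> X"
    and cover: "\<And>x. x \<in> X \<Longrightarrow> \<exists>C\<in>\<C>. (E ^^ k) `` {x} \<subseteq> C"
    and mult: "multiplicity_le X \<C> (n + 1)"
  obtains A where "\<And>x. x \<in> X \<Longrightarrow> k \<le> card {i. i < k \<and> x \<in> A i} + n"
    and "\<And>i. i < k \<Longrightarrow> A i \<subseteq> X"
    and "\<And>i. i < k \<Longrightarrow> chained E (A i) \<subseteq> (\<Union>C\<in>\<C>. C \<times> C)"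
proof
  define A where "A i = {x \<in> X. \<forall>C\<in>\<C>. x \<notin> erosion X E i C - erosion X E (Suc i) C}" for i
  show "A i \<subseteq> X" for i unfolding A_def by blast
  have deep: "\<exists>C\<in>\<C>. x \<in> erosion X E k C" if "x \<in> X" for x
    using cover[OF that] that unfolding erosion_def by blast
  have erosion_in: "x \<in> C" if "x \<in> erosion X E i C" for x i C
  proof -
    have "x \<in> erosion X E 0 C" using that erosion_antimono[OF E(1), of 0 i C] by blast
    then show ?thesis unfolding erosion_def by auto
  qed
  show "k \<le> card {i. i < k \<and> x \<in> A i} + n" if x: "x \<in> X" for x
  proof -
    obtain D where D: "D \<in> \<C>" "x \<in> erosion X E k D" using deep[OF x] by blast
    let ?C = "{C \<in> \<C>. x \<in> C}"
    have fin: "finite ?C" "card ?C \<le> n + 1"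
      using mult x unfolding multiplicity_le_def by blast+
    have "D \<in> ?C" using D erosion_in by blast
    then have cardC: "card (?C - {D}) \<le> n" using fin by simp
    let ?I = "{i. i < k \<and> x \<notin> A i}"
    \<comment> \<open>If \<open>A i\<close> misses \<open>x\<close>, then \<open>i\<close> is
      exactly the depth of \<open>x\<close> in some member \<open>g i\<close>. Depth in a given
      member is unique, so \<open>g\<close> is injective.\<close>
    have "\<exists>C\<in>\<C>. x \<in> erosion X E i C \<and> x \<notin> erosion X E (Suc i) C" if "i \<in> ?I" for i
      using that x unfolding A_def by blast
    then obtain g where g: "\<And>i. i \<in> ?I \<Longrightarrow>
        g i \<in> \<C> \<and> x \<in> erosion X E i (g i) \<and> x \<notin> erosion X E (Suc i) (g i)"
      by metis
    have "inj_on g ?I"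
    proof (rule linorder_inj_onI')
      fix i j assume ij: "i \<in> ?I" "j \<in> ?I" "i < j"
      show "g i \<noteq> g j"
        using g[OF ij(1)] g[OF ij(2)] erosion_antimono[OF E(1), of "Suc i" j "g j"] ij(3) by auto
    qed
    moreover have "g ` ?I \<subseteq> ?C - {D}"
    proof
      fix C assume "C \<in> g ` ?I"
      then obtain i where i: "i \<in> ?I" "C = g i" by blast
      \<comment> \<open>\<open>D\<close> is never chosen, since \<open>x\<close> has depth at least
        \<open>k > i\<close> in it.\<close>
      then have "x \<in> erosion X E (Suc i) D"
        using D erosion_antimono[OF E(1), of "Suc i" k D] by auto
      then show "C \<in> ?C - {D}" using g[OF i(1)] i(2) erosion_in by blast
    qed
    ultimately have "card ?I \<le> n"
      using card_inj_on_le[of g ?I "?C - {D}"] fin cardC by simp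
    moreover have "card ({i. i < k \<and> x \<in> A i} \<union> ?I) = card {i. i < k \<and> x \<in> A i} + card ?I"
      by (rule card_Un_disjoint) auto
    moreover have "{i. i < k \<and> x \<in> A i} \<union> ?I = {..<k}" by auto
    ultimately show ?thesis by simp
  qed
  show "chained E (A i) \<subseteq> (\<Union>C\<in>\<C>. C \<times> C)" if "i < k" for i
  proof clarify
    fix x y assume xy: "(x, y) \<in> chained E (A i)"
    then have x: "x \<in> A i" using chained_subset by blast
    then obtain C where C: "C \<in> \<C>" "x \<in> erosion X E k C"
      using deep unfolding A_def by blast
    have start: "x \<in> erosion X E (Suc i) C"
      using C erosion_antimono[OF E(1), of "Suc i" k C] \<open>i < k\<close> by auto
    \<comment> \<open>One step costs at most one unit of depth, and depth exactly \<open>i\<close>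
      is forbidden in \<open>A i\<close>.\<close>
    have step: "v \<in> erosion X E (Suc i) C"
      if "u \<in> erosion X E (Suc i) C" "(u, v) \<in> E \<inter> A i \<times> A i" for u v
      using erosion_step[OF that(1)] that(2) C(1) unfolding A_def by blast
    have "y \<in> erosion X E (Suc i) C"
      using xy unfolding chained_def
      by (induction rule: trancl_induct) (use start step in blast)+
    then show "(x, y) \<in> (\<Union>C\<in>\<C>. C \<times> C)"
      using C(1) start erosion_in by blast
  qed
qed

section \<open>Asymptotic dimension and decompositions\<close>

lemma multiplicity_le_mono: "multiplicity_le X \<B> m \<Longrightarrow> m \<le> n \<Longrightarrow> multiplicity_le X \<B> n"
  unfolding multiplicity_le_def by force

lemma asdim_le_mono: "asdim_le X L m \<Longrightarrow> m \<le> n \<Longrightarrow> asdim_le X L n"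
  unfolding asdim_le_def by (meson multiplicity_le_mono add_le_mono1)

lemma least_or_infinity_le_enat:
  "least_or_infinity P \<le> enat n \<Longrightarrow> \<exists>m\<le>n. P m"
  unfolding least_or_infinity_def by (auto split: if_splits intro: LeastI)

lemma least_or_infinity_le:
  "P n \<Longrightarrow> least_or_infinity P \<le> enat n"
  unfolding least_or_infinity_def by (auto intro: Least_le)

text \<open>
  Adding only the singletons of uncovered points to a family keeps its multiplicity, while the
  trivial extension may raise it by one.
\<close>

lemma asdim_le_refinement:
  assumes "asdim_le X L n" "\<B> \<in> L" "\<And>B. B \<in> \<B> \<Longrightarrow> B \<noteq> {}"
  obtains \<C> where "\<C> \<in> L" "refines \<B> \<C>" "multiplicity_le X \<C> (n + 1)"
proof -
  obtain L' where L': "generated_by X L L'" "\<And>\<C>. \<C> \<in> L' \<Longrightarrow> multiplicity_le X \<C> (n + 1)"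
    using assms(1) unfolding asdim_le_def by blast
  have L: "L = {\<B> \<in> Pow (Pow X). \<exists>\<C>\<in>L'. refines \<B> (trivial_extension X \<C>)}"
    and "L' \<subseteq> Pow (Pow X)"
    using L'(1) unfolding generated_by_def by blast+
  obtain \<C> where C: "\<C> \<in> L'" "refines \<B> (trivial_extension X \<C>)"
    using assms(2) unfolding L by blast
  define \<D> where "\<D> = \<C> \<union> (\<lambda>x. {x}) ` (X - \<Union>\<C>)"
  show thesis
  proof
    have "refines \<D> (trivial_extension X \<C>)"
      unfolding refines_def \<D>_def trivial_extension_def by blast
    moreover have "\<D> \<in> Pow (Pow X)"
      using C(1) \<open>L' \<subseteq> Pow (Pow X)\<close> unfolding \<D>_def by blast
    ultimately show "\<D> \<in> L" using C(1) unfolding L by blast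
    show "refines \<B> \<D>"
      unfolding refines_def
    proof
      fix B assume B: "B \<in> \<B>"
      then obtain C where "C \<in> trivial_extension X \<C>" "B \<subseteq> C"
        using C(2) unfolding refines_def by blast
      then consider "C \<in> \<C>" | x where "x \<in> X" "B \<subseteq> {x}"
        unfolding trivial_extension_def by blast
      then show "\<exists>D\<in>\<D>. B \<subseteq> D"
      proof cases
        case 1
        then show ?thesis using \<open>B \<subseteq> C\<close> unfolding \<D>_def by blast
      next
        case (2 x)
        have "\<exists>D\<in>\<D>. x \<in> D" using \<open>x \<in> X\<close> unfolding \<D>_def by blast
        then show ?thesis using \<open>B \<subseteq> {x}\<close> by blast
      qed
    qed
    show "multiplicity_le X \<D> (n + 1)"
      unfolding multiplicity_le_def
    proof
      fix x assume "x \<in> X"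
      show "finite {D \<in> \<D>. x \<in> D} \<and> card {D \<in> \<D>. x \<in> D} \<le> n + 1"
      proof (cases "x \<in> \<Union>\<C>")
        case True
        then have "{D \<in> \<D>. x \<in> D} = {D \<in> \<C>. x \<in> D}" unfolding \<D>_def by blast
        then show ?thesis
          using L'(2)[OF C(1)] \<open>x \<in> X\<close> unfolding multiplicity_le_def by simp
      next
        case False
        then have "{D \<in> \<D>. x \<in> D} = {{x}}" using \<open>x \<in> X\<close> unfolding \<D>_def by blast
        then show ?thesis by simp
      qed
    qed
  qed
qed

section \<open>Decompositions from a dimension bound\<close>

lemma relpow_balls_in:
  assumes L: "large_scale_structure X L" and E: "controlled X L E"
  shows "(\<lambda>x. (E ^^ k) `` {x}) ` X \<in> L"
proof -
  let ?R = "E ^^ k \<inter> X \<times> X"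
  have "E \<subseteq> X \<times> X" using E unfolding controlled_def by blast
  then have RX: "(x, y) \<in> E ^^ k \<Longrightarrow> x \<in> X \<Longrightarrow> y \<in> X" for x y
    by (cases k) auto
  have R: "controlled X L ?R" by (rule controlled_relpow[OF L E])
  \<comment> \<open>Two points of a ball are joined through its centre.\<close>
  show ?thesis
  proof (rule family_in_if_controlled[OF L controlled_comp[OF L controlled_converse[OF R] R]])
    show "(\<lambda>x. (E ^^ k) `` {x}) ` X \<subseteq> Pow X" using RX by blast
    show "B \<times> B \<subseteq> ?R\<inverse> O ?R" if "B \<in> (\<lambda>x. (E ^^ k) `` {x}) ` X" for B
      using that RX by blast
  qed
qed

lemma relpow_refl: "Id_on X \<subseteq> E \<Longrightarrow> x \<in> X \<Longrightarrow> (x, x) \<in> E ^^ k"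
  by (induction k) auto

text \<open>The balls refine a family of multiplicity at most \<open>n + 1\<close>, to which
  Kolmogorov's trick applies. Boundedness of the balls is assumed directly because the lemma also
  serves disjoint unions, for which the axioms of a large scale structure are not
  established.\<close>

lemma asdim_le_decomposition:
  assumes dim: "asdim_le X L n" and balls: "(\<lambda>x. (E ^^ k) `` {x}) ` X \<in> L"
    and E: "Id_on X \<subseteq> E" "E \<subseteq> X \<times> X"
  obtains \<C> A where "\<C> \<in> L"
    and "\<forall>x\<in>X. k \<le> card {i. i < k \<and> x \<in> A i} + n"
    and "\<forall>i<k. A i \<subseteq> X"
    and "\<forall>i<k. chained E (A i) \<subseteq> (\<Union>C\<in>\<C>. C \<times> C)"
proof -
  have "B \<noteq> {}" if "B \<in> (\<lambda>x. (E ^^ k) `` {x}) ` X" for B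
    using that relpow_refl[OF E(1)] by blast
  then obtain \<C> where C: "\<C> \<in> L" "refines ((\<lambda>x. (E ^^ k) `` {x}) ` X) \<C>"
      "multiplicity_le X \<C> (n + 1)"
    using asdim_le_refinement[OF dim balls] by blast
  have "\<exists>C\<in>\<C>. (E ^^ k) `` {x} \<subseteq> C" if "x \<in> X" for x
    using that C(2) unfolding refines_def by blast
  from kolmogorov_decomposition[OF E this C(3)] obtain A
    where A: "\<And>x. x \<in> X \<Longrightarrow> k \<le> card {i. i < k \<and> x \<in> A i} + n"
      "\<And>i. i < k \<Longrightarrow> A i \<subseteq> X" "\<And>i. i < k \<Longrightarrow> chained E (A i) \<subseteq> (\<Union>C\<in>\<C>. C \<times> C)"
    by blast
  show thesis by (rule that[OF C(1), of A]) (simp_all add: A)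
qed

lemma asdim_le_decomposition_controlled:
  assumes L: "large_scale_structure X L" and dim: "asdim_le X L n"
    and E: "controlled X L E" "Id_on X \<subseteq> E"
  obtains F A where "controlled X L F"
    and "\<forall>x\<in>X. k \<le> card {i. i < k \<and> x \<in> A i} + n"
    and "\<forall>i<k. A i \<subseteq> X"
    and "\<forall>i<k. chained E (A i) \<subseteq> F"
proof -
  have "E \<subseteq> X \<times> X" using E(1) unfolding controlled_def by blast
  from asdim_le_decomposition[where k = k, OF dim relpow_balls_in[OF L E(1)] E(2) this]
  obtain \<C> A where A: "\<C> \<in> L" "\<forall>x\<in>X. k \<le> card {i. i < k \<and> x \<in> A i} + n"
    "\<forall>i<k. A i \<subseteq> X" "\<forall>i<k. chained E (A i) \<subseteq> (\<Union>C\<in>\<C>. C \<times> C)" .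
  show thesis by (rule that[OF controlled_family[OF L A(1)] A(2-4)])
qed

section \<open>Dimension bounds from refinements and decompositions\<close>

lemma family_Un_in:
  assumes L: "large_scale_structure X L" and "\<B> \<in> L" "\<C> \<in> L"
  shows "\<B> \<union> \<C> \<in> L"
proof (rule family_in_if_controlled[OF L])
  show "controlled X L ((\<Union>B\<in>\<B>. B \<times> B) \<union> (\<Union>B\<in>\<C>. B \<times> B))"
    using controlled_Un[OF L] controlled_family[OF L] assms by blast
  show "\<B> \<union> \<C> \<subseteq> Pow X" using large_scale_structure_subset[OF L] assms by blast
qed blast

text \<open>All uniformly bounded families of multiplicity at most \<open>n + 1\<close> serve as
  generators. The union and star of two of them stay in \<open>L\<close>, so by hypothesis they
  refine a third.\<close>

lemma asdim_le_if_refinements: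
  assumes L: "large_scale_structure X L"
    and ref: "\<And>\<B>. \<B> \<in> L \<Longrightarrow> \<exists>\<C>\<in>L. refines \<B> \<C> \<and> multiplicity_le X \<C> (n + 1)"
  shows "asdim_le X L n"
proof -
  let ?L' = "{\<C> \<in> L. multiplicity_le X \<C> (n + 1)}"
  have "generated_by X L ?L'"
    unfolding generated_by_def
  proof (intro conjI ballI)
    show "?L' \<subseteq> Pow (Pow X)" using large_scale_structure_subset[OF L] by blast
  next
    fix \<B>1 \<B>2 assume "\<B>1 \<in> ?L'" "\<B>2 \<in> ?L'"
    then have "\<B>1 \<union> \<B>2 \<union> star_family \<B>1 \<B>2 \<in> L"
      using family_Un_in[OF L] large_scale_structure_star[OF L] by simp
    then show "\<exists>\<B>3\<in>?L'. refines (\<B>1 \<union> \<B>2 \<union> star_family \<B>1 \<B>2) \<B>3"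
      using ref by blast
  next
    show "L = {\<B> \<in> Pow (Pow X). \<exists>\<C>\<in>?L'. refines \<B> (trivial_extension X \<C>)}"
    proof (intro equalityI subsetI)
      fix \<B> assume "\<B> \<in> L"
      then obtain \<C> where "\<C> \<in> ?L'" "refines \<B> \<C>" using ref by blast
      then have "refines \<B> (trivial_extension X \<C>)"
        unfolding refines_def trivial_extension_def by blast
      then show "\<B> \<in> {\<B> \<in> Pow (Pow X). \<exists>\<C>\<in>?L'. refines \<B> (trivial_extension X \<C>)}"
        using \<open>\<C> \<in> ?L'\<close> large_scale_structure_subset[OF L \<open>\<B> \<in> L\<close>] by blast
    next
      fix \<B> assume "\<B> \<in> {\<B> \<in> Pow (Pow X). \<exists>\<C>\<in>?L'. refines \<B> (trivial_extension X \<C>)}"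
      then obtain \<C> where C: "\<C> \<in> L" "refines \<B> (trivial_extension X \<C>)" "\<B> \<subseteq> Pow X"
        by blast
      show "\<B> \<in> L"
        by (rule large_scale_structure_coarsen[OF L trivial_extension_in[OF L C(1)] C(3)])
           (use C(2) in \<open>unfold refines_def, blast\<close>)
    qed
  qed
  then show ?thesis unfolding asdim_le_def by blast
qed

text \<open>
  Thickening the components of each \<open>A i\<close> by \<open>E\<close> yields pairwise disjoint sets because the
  components are taken with respect to \<open>E O E\<close>.
\<close>

lemma asdim_le_if_decompositions:
  assumes L: "large_scale_structure X L"
    and dec: "\<And>E. controlled X L E \<Longrightarrow> sym E \<Longrightarrow> Id_on X \<subseteq> E \<Longrightarrow> \<exists>A H. controlled X L H \<and>
      (\<forall>x\<in>X. \<exists>i<n + 1. x \<in> A i) \<and> (\<forall>i<n + 1. A i \<subseteq> X \<and> chained E (A i) \<subseteq> H)"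
  shows "asdim_le X L n"
proof (rule asdim_le_if_refinements[OF L])
  fix \<B> assume "\<B> \<in> L"
  then obtain E where E: "controlled X L E" "(\<Union>B\<in>\<B>. B \<times> B) \<subseteq> E" "sym E" "Id_on X \<subseteq> E"
    using controlled_symmetric_reflexive[OF L controlled_family[OF L]] by metis
  have EX: "E \<subseteq> X \<times> X" using E(1) unfolding controlled_def by blast
  let ?E = "E O E"
  have symEE: "sym ?E" using E(3) unfolding sym_def by blast
  have "Id_on X \<subseteq> ?E" using E(4) by blast
  then obtain A H where H: "controlled X L H" and cov: "\<And>x. x \<in> X \<Longrightarrow> \<exists>i<n + 1. x \<in> A i"
    and A: "\<And>i. i < n + 1 \<Longrightarrow> A i \<subseteq> X" "\<And>i. i < n + 1 \<Longrightarrow> chained ?E (A i) \<subseteq> H"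
    using dec[OF controlled_comp[OF L E(1) E(1)] symEE] by blast
  define K where "K i x = E `` (chained ?E (A i) `` {x})" for i x
  \<comment> \<open>The empty set is there for a possible empty member of \<open>\<B>\<close>; it
    contributes to no multiplicity.\<close>
  define \<C> where "\<C> = insert {} (\<Union>i<n + 1. K i ` A i)"
  have KX: "K i x \<subseteq> X" for i x using EX unfolding K_def by blast
  have "\<C> \<in> L"
  proof (rule family_in_if_controlled[OF L])
    \<comment> \<open>Two points of \<open>K i x\<close> are joined by going back to
      \<open>x\<close> and out again.\<close>
    show "controlled X L (E\<inverse> O (H\<inverse> O (H O E)))"
      by (intro controlled_comp[OF L] controlled_converse E(1) H)
    show "\<C> \<subseteq> Pow X" using KX unfolding \<C>_def by blast
    show "C \<times> C \<subseteq> E\<inverse> O (H\<inverse> O (H O E))" if C: "C \<in> \<C>" for C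
    proof (rule subrelI)
      fix u v assume "(u, v) \<in> C \<times> C"
      then obtain i x where "i < n + 1" "u \<in> K i x" "v \<in> K i x"
        using C unfolding \<C>_def by blast
      then show "(u, v) \<in> E\<inverse> O (H\<inverse> O (H O E))"
        using A(2) unfolding K_def by blast
    qed
  qed
  moreover have "refines \<B> \<C>"
    unfolding refines_def
  proof
    fix B assume "B \<in> \<B>"
    show "\<exists>C\<in>\<C>. B \<subseteq> C"
    proof (cases "B = {}")
      case False
      then obtain b where b: "b \<in> B" by blast
      then have "b \<in> X" using \<open>B \<in> \<B>\<close> large_scale_structure_subset[OF L \<open>\<B> \<in> L\<close>] by blast
      then obtain i where i: "i < n + 1" "b \<in> A i" using cov by blast
      have "(b, b) \<in> ?E" using E(4) \<open>b \<in> X\<close> by blast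
      then have "(b, b) \<in> chained ?E (A i)" using i by (intro chained_step)
      \<comment> \<open>\<open>B\<close> is \<open>E\<close>-small, so all of it is within one step
        of \<open>b\<close>.\<close>
      then have "B \<subseteq> K i b" using E(2) b \<open>B \<in> \<B>\<close> unfolding K_def by blast
      then show ?thesis using i unfolding \<C>_def by blast
    qed (auto simp: \<C>_def)
  qed
  moreover have "multiplicity_le X \<C> (n + 1)"
    unfolding multiplicity_le_def
  proof
    fix x
    have same: "K i p \<subseteq> K i p'" if "x \<in> K i p" "x \<in> K i p'" for i p p'
    proof -
      let ?R = "chained ?E (A i)"
      obtain q q' where q: "(p, q) \<in> ?R" "(q, x) \<in> E" "(p', q') \<in> ?R" "(q', x) \<in> E"
        using \<open>x \<in> K i p\<close> \<open>x \<in> K i p'\<close> unfolding K_def by blast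
      \<comment> \<open>Both points are one \<open>E\<close>-step from \<open>x\<close>, hence one
        \<open>E O E\<close>-step from each other, so their components coincide.\<close>
      have "(q', q) \<in> ?E" using q E(3) unfolding sym_def by blast
      then have "(q', q) \<in> ?R" using q chained_subset by (intro chained_step) fast+
      then have "(p', p) \<in> ?R" using q chained_sym[OF symEE] chained_trans by metis
      then show ?thesis unfolding K_def using chained_trans[of p' p ?E "A i"] by blast
    qed
    \<comment> \<open>One representative per colour bounds the count. For a colour without a set
      containing \<open>x\<close> the choice is arbitrary, which is harmless as only an inclusion is
      needed.\<close>
    define p where "p i = (SOME p. x \<in> K i p)" for i
    have sub: "{C \<in> \<C>. x \<in> C} \<subseteq> (\<lambda>i. K i (p i)) ` {..<n + 1}"
    proof
      fix C assume "C \<in> {C \<in> \<C>. x \<in> C}"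
      then obtain i y where i: "i < n + 1" "C = K i y" "x \<in> K i y"
        unfolding \<C>_def by blast
      then have "x \<in> K i (p i)" unfolding p_def by (metis someI)
      then have "C = K i (p i)" using same i by blast
      then show "C \<in> (\<lambda>i. K i (p i)) ` {..<n + 1}" using i by blast
    qed
    have "card ((\<lambda>i. K i (p i)) ` {..<n + 1}) \<le> n + 1"
      using card_image_le[of "{..<n + 1}" "\<lambda>i. K i (p i)"] by simp
    with sub show "finite {C \<in> \<C>. x \<in> C} \<and> card {C \<in> \<C>. x \<in> C} \<le> n + 1"
      by (meson card_mono finite_imageI finite_lessThan finite_subset le_trans)
  qed
  ultimately show "\<exists>\<C>\<in>L. refines \<B> \<C> \<and> multiplicity_le X \<C> (n + 1)" by blast
qed

section \<open>Decompositions along a map\<close>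

text \<open>The disjoint union decomposes all preimages at once. Hence a single \<open>F\<close>
  bounds the chains over every member of \<open>\<B>\<close>, although the sets \<open>A i B\<close>
  depend on \<open>B\<close>.\<close>

lemma asdim_map_le_fibre_decomposition:
  assumes L: "large_scale_structure X LX" and dim: "asdim_map_le X LX LY f m"
    and B: "\<B> \<in> LY" and E: "controlled X LX E" "Id_on X \<subseteq> E"
  obtains F A where "controlled X LX F"
    and "\<forall>B\<in>\<B>. \<forall>x\<in>X. f x \<in> B \<longrightarrow> k \<le> card {i. i < k \<and> x \<in> A i B} + m"
    and "\<forall>B\<in>\<B>. \<forall>i<k. chained E (A i B) \<subseteq> F"
proof -
  define \<A> where "\<A> = preimage_family X f \<B>"
  define S where "S = family_sum \<A>"
  define LS where "LS = family_sum_structure LX \<A>"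
  have AX: "s \<subseteq> X" if "s \<in> \<A>" for s
    using that unfolding \<A>_def preimage_family_def by blast
  have S: "(s, x) \<in> S \<longleftrightarrow> s \<in> \<A> \<and> x \<in> s" for s x
    unfolding S_def family_sum_def by auto
  have LS: "\<G> \<in> LS \<longleftrightarrow> \<G> \<subseteq> Pow S \<and> (\<forall>G\<in>\<G>. \<exists>s\<in>\<A>. G \<subseteq> {s} \<times> s) \<and>
      (\<exists>\<D>\<in>LX. \<forall>s\<in>\<A>. \<forall>G\<in>\<G>. G \<subseteq> {s} \<times> s \<longrightarrow> (\<exists>D\<in>\<D>. snd ` G \<subseteq> D))" for \<G>
    unfolding LS_def S_def family_sum_structure_def disjoint_union_structure_def family_sum_def
    by simp
  have "asdim S LS \<le> enat m"
    using dim B unfolding asdim_map_le_def S_def LS_def \<A>_def by blast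
  then obtain m' where "m' \<le> m" "asdim_le S LS m'"
    unfolding asdim_def by (blast dest: least_or_infinity_le_enat)
  then have dimS: "asdim_le S LS m" by (rule asdim_le_mono[rotated])
  \<comment> \<open>This copies \<open>E\<close> into each summand. No pair joins different
    summands, so balls stay in one summand and project into \<open>E\<close>-balls.\<close>
  define E' where "E' = {(p, q). p \<in> S \<and> q \<in> S \<and> fst p = fst q \<and> (snd p, snd q) \<in> E}"
  have E': "Id_on S \<subseteq> E'" "E' \<subseteq> S \<times> S"
    using E(2) AX unfolding E'_def by (fastforce simp: S)+
  have pow: "fst p = fst q \<and> (snd p, snd q) \<in> E ^^ j" if "(p, q) \<in> E' ^^ j" for p q j
    using that
  proof (induction j arbitrary: q)
    case (Suc j)
    then obtain r where "(p, r) \<in> E' ^^ j" "(r, q) \<in> E'" by auto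
    with Suc.IH[of r] show ?case unfolding E'_def by auto
  qed simp
  have powS: "(p, q) \<in> E' ^^ j \<Longrightarrow> p \<in> S \<Longrightarrow> q \<in> S" for p q j
    using E'(2) by (cases j) auto
  have "(\<lambda>p. (E' ^^ k) `` {p}) ` S \<in> LS"
    unfolding LS
  proof (intro conjI ballI bexI[of _ "(\<lambda>x. (E ^^ k) `` {x}) ` X"] impI)
    show "(\<lambda>p. (E' ^^ k) `` {p}) ` S \<subseteq> Pow S" using powS by blast
  next
    fix G assume "G \<in> (\<lambda>p. (E' ^^ k) `` {p}) ` S"
    then obtain s x where sx: "(s, x) \<in> S" "G = (E' ^^ k) `` {(s, x)}" by auto
    have "G \<subseteq> {s} \<times> s"
    proof
      fix q assume "q \<in> G"
      then have "((s, x), q) \<in> E' ^^ k" using sx by simp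
      from pow[OF this] powS[OF this sx(1)] show "q \<in> {s} \<times> s" using S by (cases q) auto
    qed
    then show "\<exists>s\<in>\<A>. G \<subseteq> {s} \<times> s" using sx S by blast
  next
    fix s G assume "G \<in> (\<lambda>p. (E' ^^ k) `` {p}) ` S"
    then obtain t x where tx: "(t, x) \<in> S" "G = (E' ^^ k) `` {(t, x)}" by auto
    have "snd ` G \<subseteq> (E ^^ k) `` {x}" using pow tx(2) by fastforce
    moreover have "x \<in> X" using tx S AX by blast
    ultimately show "\<exists>D\<in>(\<lambda>x. (E ^^ k) `` {x}) ` X. snd ` G \<subseteq> D" by blast
  qed (rule relpow_balls_in[OF L E(1)])
  from asdim_le_decomposition[OF dimS this E'] obtain \<C> A' where C: "\<C> \<in> LS"
    and "\<forall>p\<in>S. k \<le> card {i. i < k \<and> p \<in> A' i} + m"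
      "\<forall>i<k. A' i \<subseteq> S" "\<forall>i<k. chained E' (A' i) \<subseteq> (\<Union>C\<in>\<C>. C \<times> C)" .
  note A' = this(2-4)[rule_format]
  from C obtain \<D> where D: "\<D> \<in> LX"
      "\<forall>s\<in>\<A>. \<forall>G\<in>\<C>. G \<subseteq> {s} \<times> s \<longrightarrow> (\<exists>D\<in>\<D>. snd ` G \<subseteq> D)"
    and summand: "\<forall>G\<in>\<C>. \<exists>s\<in>\<A>. G \<subseteq> {s} \<times> s"
    unfolding LS by (elim conjE bexE)
  have snd_C: "\<exists>D\<in>\<D>. snd ` C \<subseteq> D" if "C \<in> \<C>" for C
    using bspec[OF summand that] D(2) that by blast
  \<comment> \<open>\<open>A i B\<close> is the slice of \<open>A' i\<close> over the summand of
    \<open>B\<close>; chains in a slice lift to chains in \<open>A' i\<close>.\<close>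
  show thesis
  proof (intro that ballI allI impI)
    show "controlled X LX (\<Union>D\<in>\<D>. D \<times> D)" by (rule controlled_family[OF L D(1)])
  next
    fix B x assume "B \<in> \<B>" "x \<in> X" "f x \<in> B"
    then have "(f -` B \<inter> X, x) \<in> S"
      unfolding S \<A>_def preimage_family_def by blast
    from A'(1)[OF this]
    show "k \<le> card {i. i < k \<and> x \<in> {x. (f -` B \<inter> X, x) \<in> A' i}} + m" by simp
  next
    fix B i assume "B \<in> \<B>" and i: "i < k"
    let ?s = "f -` B \<inter> X"
    show "chained E {x. (?s, x) \<in> A' i} \<subseteq> (\<Union>D\<in>\<D>. D \<times> D)"
    proof (rule subrelI)
      fix x y assume "(x, y) \<in> chained E {x. (?s, x) \<in> A' i}"
      then have "((?s, x), (?s, y)) \<in> chained E' (A' i)"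
        unfolding chained_def[of E]
      proof (induction rule: trancl_induct)
        case (base y)
        then show ?case using A'(2)[OF i] by (intro chained_step) (auto simp: E'_def)
      next
        case (step y z)
        then have "((?s, y), (?s, z)) \<in> chained E' (A' i)"
          using A'(2)[OF i] by (intro chained_step) (auto simp: E'_def)
        with step.IH show ?case by (rule chained_trans)
      qed
      then obtain C where "C \<in> \<C>" "(?s, x) \<in> C" "(?s, y) \<in> C" using A'(3)[OF i] by blast
      then have "x \<in> snd ` C" "y \<in> snd ` C" by (metis image_eqI snd_conv)+
      then show "(x, y) \<in> (\<Union>D\<in>\<D>. D \<times> D)" using snd_C[OF \<open>C \<in> \<C>\<close>] by blast
    qed
  qed
qed

text \<open>The \<open>V\<close>-components of \<open>P\<close> are uniformly bounded, so the
  decompositions of their preimages have a common bound and can be glued. A chain whose image stays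
  in a \<open>V\<close>-small \<open>Z\<close> sees only one component.\<close>

lemma asdim_map_le_piece_decomposition:
  assumes LX: "large_scale_structure X LX" and LY: "large_scale_structure Y LY"
    and dim: "asdim_map_le X LX LY f m"
    and V: "sym V" "Id_on P \<subseteq> V" "controlled Y LY W" "chained V P \<subseteq> W"
    and E: "controlled X LX E" "Id_on X \<subseteq> E"
  obtains F A where "controlled X LX F"
    and "\<forall>x\<in>X. f x \<in> P \<longrightarrow> k \<le> card {i. i < k \<and> x \<in> A i} + m"
    and "\<forall>i<k. A i \<subseteq> X"
    and "\<forall>i<k. \<forall>Z. Z \<times> Z \<subseteq> V \<longrightarrow> chained E (A i \<inter> f -` Z) \<subseteq> F"
proof -
  define K where "K y = chained V P `` {y}" for y
  have WY: "W \<subseteq> Y \<times> Y" using V(3) unfolding controlled_def by blast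
  have "K ` P \<in> LY"
  proof (rule family_in_if_controlled[OF LY])
    show "controlled Y LY (W\<inverse> O W)"
      by (rule controlled_comp[OF LY controlled_converse]) fact+
    show "K ` P \<subseteq> Pow Y" using V(4) WY unfolding K_def by blast
    show "B \<times> B \<subseteq> W\<inverse> O W" if "B \<in> K ` P" for B
      using that V(4) unfolding K_def by blast
  qed
  from asdim_map_le_fibre_decomposition[where k = k, OF LX dim this E] 
  obtain F A where F: "controlled X LX F"
    and "\<forall>B\<in>K ` P. \<forall>x\<in>X. f x \<in> B \<longrightarrow> k \<le> card {i. i < k \<and> x \<in> A i B} + m"
      "\<forall>B\<in>K ` P. \<forall>i<k. chained E (A i B) \<subseteq> F" .
  note A = this(2,3)[rule_format]
  \<comment> \<open>Whether \<open>x\<close> belongs to the glued set is decided by the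
    decomposition over the component of \<open>f x\<close>.\<close>
  show thesis
  proof (intro that ballI allI impI)
    show "controlled X LX F" by fact
  next
    fix x assume x: "x \<in> X" "f x \<in> P"
    have "f x \<in> K (f x)" using x(2) V(2) chained_step[of "f x" "f x" V P] unfolding K_def by blast
    then show "k \<le> card {i. i < k \<and> x \<in> {x \<in> X. f x \<in> P \<and> x \<in> A i (K (f x))}} + m"
      using A(1)[of "K (f x)" x] x by simp
  next
    fix i Z assume i: "i < k" and Z: "Z \<times> Z \<subseteq> V"
    let ?A = "{x \<in> X. f x \<in> P \<and> x \<in> A i (K (f x))} \<inter> f -` Z"
    have same: "K y \<subseteq> K z" if "y \<in> Z \<inter> P" "z \<in> Z \<inter> P" for y z
    proof -
      have "(z, y) \<in> chained V P" using that Z by (intro chained_step) auto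
      then show ?thesis using chained_trans[of z y V P] unfolding K_def by blast
    qed
    show "chained E ?A \<subseteq> F"
    proof (rule subrelI)
      fix x y assume xy: "(x, y) \<in> chained E ?A"
      then have x: "x \<in> ?A" using chained_subset by blast
      have "?A \<subseteq> A i (K (f x))"
      proof
        fix z assume z: "z \<in> ?A"
        then have "K (f z) = K (f x)" using x same by blast
        then show "z \<in> A i (K (f x))" using z by simp
      qed
      then have "(x, y) \<in> chained E (A i (K (f x)))" using xy chained_mono by blast
      then show "(x, y) \<in> F" using A(2)[OF _ i] x by blast
    qed
  qed blast
qed

text \<open>
  Each further piece of \<open>Y\<close> is handled at a scale that absorbs the bound obtained for the
  previous ones.
\<close>

lemma asdim_map_le_pieces_decomposition:
  assumes LX: "large_scale_structure X LX" and LY: "large_scale_structure Y LY"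
    and dim: "asdim_map_le X LX LY f m"
    and V: "sym V" "controlled Y LY W"
      "\<forall>j<N::nat. Id_on (P j) \<subseteq> V \<and> chained V (P j) \<subseteq> W"
    and E: "controlled X LX E" "Id_on X \<subseteq> E"
  shows "\<exists>A H. controlled X LX H \<and>
     (\<forall>x\<in>X. (\<exists>j<N. f x \<in> P j) \<longrightarrow> k \<le> card {i. i < k \<and> x \<in> A i} + m) \<and>
     (\<forall>i<k. A i \<subseteq> X) \<and> (\<forall>i<k. \<forall>Z. Z \<times> Z \<subseteq> V \<longrightarrow> chained E (A i \<inter> f -` Z) \<subseteq> H)"
  using V(3)
proof (induction N)
  case 0
  have "chained E {} \<subseteq> Id_on X" using chained_subset by blast
  then show ?case
    by (intro exI[of _ "\<lambda>_. {}"] exI[of _ "Id_on X"]) (simp add: controlled_Id_on[OF LX])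
next
  case (Suc N)
  have "\<forall>j<N. Id_on (P j) \<subseteq> V \<and> chained V (P j) \<subseteq> W"
    using Suc.prems by simp
  note IH = Suc.IH[OF this]
  have PN: "Id_on (P N) \<subseteq> V" "chained V (P N) \<subseteq> W"
    using Suc.prems by simp_all
  obtain A F where F: "controlled X LX F"
    and "\<forall>x\<in>X. (\<exists>j<N. f x \<in> P j) \<longrightarrow> k \<le> card {i. i < k \<and> x \<in> A i} + m"
      "\<forall>i<k. A i \<subseteq> X"
      "\<forall>i<k. \<forall>Z. Z \<times> Z \<subseteq> V \<longrightarrow> chained E (A i \<inter> f -` Z) \<subseteq> F"
    using IH by (elim exE conjE) (rule that)
  note A = this(2-4)[rule_format]
  let ?E = "E \<union> E O F O E"
  have cE: "controlled X LX ?E"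
    by (intro controlled_Un[OF LX] controlled_comp[OF LX] E(1) F)
  have IdE: "Id_on X \<subseteq> ?E" using E(2) by blast
  obtain F' A' where F': "controlled X LX F'"
    and "\<forall>x\<in>X. f x \<in> P N \<longrightarrow> k \<le> card {i. i < k \<and> x \<in> A' i} + m"
      "\<forall>i<k. A' i \<subseteq> X"
      "\<forall>i<k. \<forall>Z. Z \<times> Z \<subseteq> V \<longrightarrow> chained ?E (A' i \<inter> f -` Z) \<subseteq> F'"
    using asdim_map_le_piece_decomposition[where k = k, OF LX LY dim V(1) PN(1) V(2) PN(2) cE IdE] .
  note A' = this(2-4)[rule_format]
  \<comment> \<open>The bound of \<open>chained_Un\<close> with \<open>Id_on ?Q\<close> enlarged to
    \<open>Id_on X\<close>, which makes it independent of \<open>i\<close> and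
    \<open>Z\<close>.\<close>
  let ?I = "Id_on X"
  let ?H = "F \<union> (?I \<union> F O E) O (?I \<union> F') O (?I \<union> E O F)"
  show ?case
  proof (intro exI[of _ "\<lambda>i. A i \<union> A' i"] exI[of _ ?H] conjI ballI allI impI)
    show "controlled X LX ?H"
      by (intro controlled_Un[OF LX] controlled_comp[OF LX] controlled_Id_on[OF LX] E(1) F F')
  next
    fix x assume x: "x \<in> X" and "\<exists>j<Suc N. f x \<in> P j"
    then consider "\<exists>j<N. f x \<in> P j" | "f x \<in> P N" by (metis less_Suc_eq)
    then show "k \<le> card {i. i < k \<and> x \<in> A i \<union> A' i} + m"
    proof cases
      case 1
      have "card {i. i < k \<and> x \<in> A i} \<le> card {i. i < k \<and> x \<in> A i \<union> A' i}"
        by (rule card_mono) auto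
      then show ?thesis using A(1)[OF x 1] by linarith
    next
      case 2
      have "card {i. i < k \<and> x \<in> A' i} \<le> card {i. i < k \<and> x \<in> A i \<union> A' i}"
        by (rule card_mono) auto
      then show ?thesis using A'(1)[OF x 2] by linarith
    qed
  next
    fix i assume "i < k"
    then show "A i \<union> A' i \<subseteq> X" using A(2) A'(2) by blast
  next
    fix i Z assume i: "i < k" and Z: "Z \<times> Z \<subseteq> V"
    let ?P = "A i \<inter> f -` Z" and ?Q = "A' i \<inter> f -` Z"
    have "Id_on ?P \<subseteq> E" using E(2) A(2)[OF i] by blast
    from chained_Un[OF A(3)[OF i Z] A'(3)[OF i Z] subset_refl this]
    have "chained E (?P \<union> ?Q)
        \<subseteq> F \<union> (Id_on ?Q \<union> F O E) O (Id_on ?Q \<union> F') O (Id_on ?Q \<union> E O F)" .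
    also have "\<dots> \<subseteq> ?H"
      using A'(2)[OF i] by (intro Un_mono relcomp_mono subset_refl) auto
    finally show "chained E ((A i \<union> A' i) \<inter> f -` Z) \<subseteq> ?H"
      by (simp only: Int_Un_distrib2)
  qed
qed

section \<open>Addition of dimensions\<close>

lemma ex_common_index:
  fixes k :: nat
  assumes "k \<le> card {i. i < k \<and> Q i} + m" "k \<le> card {i. i < k \<and> R i} + n" "m + n < k"
  shows "\<exists>i<k. Q i \<and> R i"
proof (rule ccontr)
  assume "\<not> ?thesis"
  then have "card ({i. i < k \<and> Q i} \<union> {i. i < k \<and> R i})
      = card {i. i < k \<and> Q i} + card {i. i < k \<and> R i}"
    by (intro card_Un_disjoint) auto
  moreover have "card ({i. i < k \<and> Q i} \<union> {i. i < k \<and> R i}) \<le> card {..<k}"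
    by (rule card_mono) auto
  ultimately show False using assms by simp
qed

text \<open>The scales are fixed in turn: \<open>G\<close> contains the image of \<open>E\<close>,
  \<open>V0\<close> bounds the \<open>G\<close>-chains in the sets \<open>B i\<close>, the pieces
  \<open>P j\<close> are cut at a scale \<open>V\<close> containing \<open>V0\<close>, and only then
  are the sets \<open>A i\<close> glued along these pieces.\<close>

theorem asdim_le_add:
  assumes LX: "large_scale_structure X LX" and LY: "large_scale_structure Y LY"
    and f: "f \<in> X \<rightarrow> Y" "large_scale_uniform LX LY f"
    and dim: "asdim_map_le X LX LY f m" "asdim_le Y LY n"
  shows "asdim_le X LX (m + n)"
proof (rule asdim_le_if_decompositions[OF LX])
  fix E assume E: "controlled X LX E" "sym E" "Id_on X \<subseteq> E"
  let ?k = "m + n + 1"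
  obtain G where G: "controlled Y LY G" "map_prod f f ` E \<subseteq> G" "sym G" "Id_on Y \<subseteq> G"
    using controlled_symmetric_reflexive[OF LY controlled_image[OF LY f(2,1) E(1)]] .
  obtain V0 B where V0: "controlled Y LY V0"
    and "\<forall>y\<in>Y. ?k \<le> card {i. i < ?k \<and> y \<in> B i} + n"
      "\<forall>i<?k. B i \<subseteq> Y" "\<forall>i<?k. chained G (B i) \<subseteq> V0"
    using asdim_le_decomposition_controlled[OF LY dim(2) G(1,4), of ?k] .
  note B = this(2-4)[rule_format]
  obtain V where V: "controlled Y LY V" "V0 \<subseteq> V" "sym V" "Id_on Y \<subseteq> V"
    using controlled_symmetric_reflexive[OF LY V0] .
  \<comment> \<open>For \<open>n + 1\<close> colours the count just says that each point of
    \<open>Y\<close> lies in some \<open>P j\<close>.\<close>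
  obtain W P where W: "controlled Y LY W"
    and "\<forall>y\<in>Y. n + 1 \<le> card {j. j < n + 1 \<and> y \<in> P j} + n"
      "\<forall>j<n + 1. P j \<subseteq> Y" "\<forall>j<n + 1. chained V (P j) \<subseteq> W"
    using asdim_le_decomposition_controlled[OF LY dim(2) V(1,4), of "n + 1"] .
  note P = this(2-4)[rule_format]
  have VP: "\<forall>j<n + 1. Id_on (P j) \<subseteq> V \<and> chained V (P j) \<subseteq> W"
    using P(2,3) V(4) by blast
  obtain A H where H: "controlled X LX H"
    and "\<forall>x\<in>X. (\<exists>j<n + 1. f x \<in> P j) \<longrightarrow> ?k \<le> card {i. i < ?k \<and> x \<in> A i} + m"
      "\<forall>i<?k. A i \<subseteq> X"
      "\<forall>i<?k. \<forall>Z. Z \<times> Z \<subseteq> V \<longrightarrow> chained E (A i \<inter> f -` Z) \<subseteq> H"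
    using asdim_map_le_pieces_decomposition[where k = ?k and N = "n + 1" and P = P,
        OF LX LY dim(1) V(3) W VP E(1,3)]
    by (elim exE conjE) (rule that)
  note A = this(2-4)[rule_format]
  let ?A = "\<lambda>i. A i \<inter> f -` B i"
  show "\<exists>A H. controlled X LX H \<and> (\<forall>x\<in>X. \<exists>i<?k. x \<in> A i) \<and>
      (\<forall>i<?k. A i \<subseteq> X \<and> chained E (A i) \<subseteq> H)"
  proof (intro exI[of _ ?A] exI[of _ H] conjI ballI allI impI)
    show "controlled X LX H" by fact
  next
    fix x assume x: "x \<in> X"
    then have y: "f x \<in> Y" using f(1) by blast
    have "{j. j < n + 1 \<and> f x \<in> P j} \<noteq> {}"
    proof
      assume "{j. j < n + 1 \<and> f x \<in> P j} = {}"
      with P(1)[OF y] show False by (simp del: Collect_empty_eq)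
    qed
    then have "\<exists>j<n + 1. f x \<in> P j" by blast
    from ex_common_index[OF A(1)[OF x this] B(1)[OF y]]
    show "\<exists>i<?k. x \<in> ?A i" by simp
  next
    fix i assume "i < ?k"
    then show "?A i \<subseteq> X" using A(2) by blast
  next
    fix i assume i: "i < ?k"
    let ?R = "chained G (B i)"
    show "chained E (?A i) \<subseteq> H"
    proof (rule subrelI)
      fix x y assume xy: "(x, y) \<in> chained E (?A i)"
      then have x: "x \<in> ?A i" using chained_subset by blast
      \<comment> \<open>The \<open>G\<close>-component of \<open>f x\<close> in \<open>B i\<close>
        is \<open>V0\<close>-small, which makes it admissible in the bound for
        \<open>A i\<close>.\<close>
      define Z where "Z = ?R `` {f x}"
      have "Z \<times> Z \<subseteq> ?R"
      proof (rule subrelI)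
        fix u v assume "(u, v) \<in> Z \<times> Z"
        then have "(f x, u) \<in> ?R" "(f x, v) \<in> ?R" unfolding Z_def by blast+
        then show "(u, v) \<in> ?R" using chained_sym[OF G(3)] chained_trans by metis
      qed
      then have Z: "Z \<times> Z \<subseteq> V" using B(3)[OF i] V(2) by blast
      have "f x \<in> Y" using x B(2)[OF i] by blast
      then have fx: "f x \<in> Z"
        using x G(4) chained_step[of "f x" "f x" G "B i"] unfolding Z_def by blast
      \<comment> \<open>An \<open>E\<close>-step in \<open>?A i\<close> maps to a
        \<open>G\<close>-step in \<open>B i\<close>, which cannot leave the component.\<close>
      have stays: "f v \<in> Z" if "f u \<in> Z" "(u, v) \<in> E \<inter> ?A i \<times> ?A i" for u v
      proof -
        have "(f u, f v) \<in> ?R" using that(2) G(2) by (intro chained_step) auto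
        then show ?thesis using that(1) chained_trans[of "f x" "f u" G "B i"] unfolding Z_def by blast
      qed
      have "f y \<in> Z \<and> (x, y) \<in> chained E (A i \<inter> f -` Z)"
        using xy unfolding chained_def[of E "?A i"]
      proof (induction rule: trancl_induct)
        case (base y)
        then have "f y \<in> Z" using stays fx by blast
        then show ?case using base fx by (auto intro: chained_step)
      next
        case (step y z)
        then have "f z \<in> Z" using stays by blast
        moreover have "(y, z) \<in> chained E (A i \<inter> f -` Z)"
          using step calculation by (intro chained_step) auto
        ultimately show ?case using step.IH chained_trans by fast
      qed
      then show "(x, y) \<in> H" using A(3)[OF i Z] by blast
    qed
  qed
qed

theorem theorem4p3:
  fixes X :: "'a set" and Y :: "'b set"
    and LX :: "'a set set set" and LY :: "'b set set set"
    and f :: "'a \<Rightarrow> 'b"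
  assumes "large_scale_structure X LX"
    and "large_scale_structure Y LY"
    and "f \<in> X \<rightarrow> Y"
    and "large_scale_uniform LX LY f"
  shows "asdim X LX \<le> asdim_map X LX LY f + asdim Y LY"
proof (cases "asdim_map X LX LY f = \<infinity> \<or> asdim Y LY = \<infinity>")
  case True
  then show ?thesis by auto
next
  case False
  then obtain m n where mn: "asdim_map X LX LY f = enat m" "asdim Y LY = enat n" by auto
  \<comment> \<open>A finite value of \<open>least_or_infinity\<close> is attained.\<close>
  have "asdim_map_le X LX LY f m"
    using mn(1) unfolding asdim_map_def least_or_infinity_def by (auto split: if_splits intro: LeastI)
  moreover have "asdim_le Y LY n"
    using mn(2) unfolding asdim_def least_or_infinity_def by (auto split: if_splits intro: LeastI)
  ultimately have "asdim_le X LX (m + n)" by (rule asdim_le_add[OF assms])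
  then have "asdim X LX \<le> enat (m + n)"
    unfolding asdim_def by (rule least_or_infinity_le)
  then show ?thesis
    unfolding mn plus_enat_simps .
qed

end
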